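(* Let $1\le r\le n$ be integers, let $\mathcal{S}\subset\mathbb{R}^{n\times r}$ be a set containing $\mathbb{S}^{n,r}_+$, let $F:\mathcal{S}\to\mathbb{R}$ be an $L$-Lipschitz function with $L\in(0,\infty)$, i.e. $|F(X)-F(Y)|\le L\|X-Y\|_F$ for all $X,Y\in\mathcal{S}$, and let $p\ge1$ be a constant. If $0<q\le1/2$ and $\mu>5Lr^{3/4}\max\{1,(nr)^{\frac{p-2}{4p}}\}$, then $$\operatorname{Argmin}\{F(X):X\in\mathbb{S}^{n,r}_+\}=\operatorname{Argmin}\left\{F(X)+\mu\left(\|X_-\|_{\ell_p}^{q}+\|X^{T}X-I_r\|_{\ell_p}^{1/2}\right):X\in\mathcal{S}\right\}.$$
   Context: $\mathbb{S}^{n,r}_+=\{X\in\mathbb{R}^{n\times r}:X^{T}X=I_r,\ X\ge0\}$ (entry-wise inequality) is the nonnegative Stiefel manifold. For a matrix $Y$, $Y_-=\max\{-Y,0\}$ entry-wise. $\|\cdot\|_F$ is the Frobenius norm; for $p\in[1,\infty)$, $\|\cdot\|_{\ell_p}$ is the entry-wise $\ell_p$-norm of a matrix, i.e. the $\ell_p$-norm of the vector of all its entries. $\operatorname{Argmin}$ denotes the set of global minimizers of a minimization problem. *)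

theory Defs
  imports "HOL-Analysis.Analysis"
begin

text \<open>
  An \<open>n \<times> r\<close> matrix has type \<open>real ^ 'r ^ 'n\<close>, with \<open>n = CARD('n)\<close> and \<open>r = CARD('r)\<close>.  On this
  type \<open>norm\<close>, and hence \<open>dist\<close> and \<open>lipschitz_on\<close>, refer to the Frobenius norm:
\<close>

lemma norm_matrix_frobenius:
  fixes X :: "real ^ 'r ^ 'n"
  shows "norm X = sqrt (\<Sum>i\<in>UNIV. \<Sum>j\<in>UNIV. (X $ i $ j)\<^sup>2)"
  by (simp add: norm_vec_def L2_set_def sum_nonneg)

definition nonneg_stiefel :: "(real ^ 'r ^ 'n) set" where
  "nonneg_stiefel = {X. transpose X ** X = mat 1 \<and> (\<forall>i j. 0 \<le> X $ i $ j)}"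

definition neg_part_matrix :: "real ^ 'r ^ 'n \<Rightarrow> real ^ 'r ^ 'n" where
  "neg_part_matrix Y = (\<chi> i j. max (- (Y $ i $ j)) 0)"

definition entrywise_lp_norm :: "real \<Rightarrow> real ^ 'r ^ 'n \<Rightarrow> real" where
  "entrywise_lp_norm p Y = (\<Sum>i\<in>UNIV. \<Sum>j\<in>UNIV. \<bar>Y $ i $ j\<bar> powr p) powr (1 / p)"

definition Argmin :: "('a \<Rightarrow> real) \<Rightarrow> 'a set \<Rightarrow> 'a set" where
  "Argmin f A = {x. is_arg_min f (\<lambda>y. y \<in> A) x}"

end

theory Submission
  imports Defs
begin

text \<open>
  For an \<open>L\<close>-Lipschitz objective a penalty is exact as soon as the distance to the feasible set is
  bounded by a multiple \<open>K\<close> of the penalty with \<open>L * K < \<mu>\<close> (\<open>Argmin_exact_penalty\<close>).  The theorem is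
  therefore an error bound for the nonnegative Stiefel manifold: writing \<open>\<epsilon>\<close> and \<open>\<delta>\<close> for the Frobenius
  norms of \<open>neg_part_matrix X\<close> and \<open>transpose X ** X - mat 1\<close>, each \<open>X\<close> has a feasible matrix within
  distance \<open>5 * r powr (3 / 4) * (sqrt \<epsilon> + sqrt \<delta>)\<close>, where \<open>r = CARD('r)\<close>
  (\<open>nonneg_stiefel_error_bound\<close>).

  A nonnegative matrix has orthogonal columns iff each row has at most one nonzero entry.  So \<open>X\<close> is
  rounded by taking its positive part, keeping one largest entry in each row, and normalizing the
  columns.  The squared mass dropped from a column is at most the sum of its inner products with the
  other columns, because a dropped entry does not exceed the kept one.  These inner products are small
  by near-orthogonality of the columns of \<open>X\<close>, of order \<open>sqrt r * (\<delta> + \<epsilon>)\<close>; the square root in the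
  error bound appears here (\<open>column_overlap_pos_part_le\<close>,
  \<open>exists_nonneg_stiefel_near_small_overlap\<close>).

  The rounding breaks down only if a column loses all its entries, which requires
  \<open>sqrt \<epsilon> + sqrt \<delta>\<close> to be at least of order \<open>r powr (- 1 / 4)\<close>.  In that range the right-hand side
  exceeds the distance to an arbitrary feasible matrix, since the Gram residual controls \<open>norm X\<close>
  (\<open>dist_nonneg_stiefel_le_large_residual\<close>).  The same estimate covers exponents \<open>q < 1 / 2\<close> when the
  negative part is large.  Finally, the factor \<open>(n * r) powr ((p - 2) / (4 * p))\<close> with
  \<open>n = CARD('n)\<close> is the square root of the constant that compares the Frobenius norm with the entrywise
  \<open>\<ell>\<^sub>p\<close>-norm.
\<close>

section \<open>Exact penalization from an error bound\<close>

text \<open>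
  Replacing \<open>x\<close> by a nearby point of \<open>A\<close> raises \<open>F\<close> by at most \<open>L * K * c x\<close>, which a weight
  \<open>\<mu> > L * K\<close> outbids.  Strictness of this inequality forces \<open>c x = 0\<close> at a penalized minimizer, and
  the error bound then puts \<open>x\<close> into \<open>A\<close>.
\<close>
lemma Argmin_exact_penalty:
  fixes F :: "'a :: metric_space \<Rightarrow> real"
  assumes lip: "L-lipschitz_on S F" and sub: "A \<subseteq> S"
    and zero: "\<And>x. x \<in> A \<Longrightarrow> c x = 0" and nonneg: "\<And>x. x \<in> S \<Longrightarrow> 0 \<le> c x"
    and error_bound: "\<And>x. x \<in> S \<Longrightarrow> \<exists>w\<in>A. dist x w \<le> K * c x"
    and large: "L * K < \<mu>"
  shows "Argmin F A = Argmin (\<lambda>x. F x + \<mu> * c x) S"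
proof -
  have near: "\<exists>w\<in>A. F w \<le> F x + L * K * c x \<and> dist x w \<le> K * c x" if "x \<in> S" for x
  proof -
    obtain w where w: "w \<in> A" "dist x w \<le> K * c x" using error_bound[OF \<open>x \<in> S\<close>] by blast
    have "dist (F x) (F w) \<le> L * dist x w"
      using lipschitz_onD[OF lip] w(1) sub that by blast
    also have "\<dots> \<le> L * (K * c x)"
      using w(2) lipschitz_on_nonneg[OF lip] by (rule mult_left_mono)
    finally have "F w \<le> F x + L * K * c x" by (simp add: dist_real_def abs_le_iff algebra_simps)
    then show ?thesis using w by blast
  qed
  show ?thesis
  proof (intro set_eqI iffI)
    fix x assume x: "x \<in> Argmin F A"
    then have xA: "x \<in> A" and min: "\<And>w. w \<in> A \<Longrightarrow> F x \<le> F w"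
      by (auto simp: Argmin_def is_arg_min_linorder)
    have "F x + \<mu> * c x \<le> F y + \<mu> * c y" if "y \<in> S" for y
    proof -
      obtain w where "w \<in> A" "F w \<le> F y + L * K * c y" using near \<open>y \<in> S\<close> by blast
      moreover have "L * K * c y \<le> \<mu> * c y"
        using large nonneg \<open>y \<in> S\<close> by (intro mult_right_mono) auto
      ultimately show ?thesis using min[of w] zero[OF xA] by simp
    qed
    then show "x \<in> Argmin (\<lambda>x. F x + \<mu> * c x) S"
      using xA sub by (auto simp: Argmin_def is_arg_min_linorder)
  next
    fix x assume x: "x \<in> Argmin (\<lambda>x. F x + \<mu> * c x) S"
    then have xS: "x \<in> S" and min: "\<And>y. y \<in> S \<Longrightarrow> F x + \<mu> * c x \<le> F y + \<mu> * c y"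
      by (auto simp: Argmin_def is_arg_min_linorder)
    obtain w where w: "w \<in> A" "F w \<le> F x + L * K * c x" "dist x w \<le> K * c x"
      using near[OF xS] by blast
    have "F x + \<mu> * c x \<le> F w" using min[of w] w(1) sub zero[of w] by auto
    with w(2) have "(\<mu> - L * K) * c x \<le> 0" by (simp add: algebra_simps)
    then have c0: "c x = 0" using large nonneg[OF xS] by (simp add: mult_le_0_iff)
    then have xA: "x \<in> A" using w(1,3) by simp
    have "F x \<le> F y" if "y \<in> A" for y
      using min[of y] that sub zero[OF that] c0 by auto
    then show "x \<in> Argmin F A" using xA by (auto simp: Argmin_def is_arg_min_linorder)
  qed
qed

section \<open>Frobenius norm against entrywise norms\<close>

text \<open>
  After scaling the \<open>\<ell>\<^sub>p\<close>-norm to 1 all entries lie in \<open>[0, 1]\<close>, where a larger exponent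
  gives a smaller power.
\<close>
lemma L2_set_le_lp_sum_of_le_2:
  assumes "finite A" "1 \<le> p" "p \<le> 2"
  shows "L2_set a A \<le> (\<Sum>i\<in>A. \<bar>a i\<bar> powr p) powr (1 / p)"
proof -
  define T where "T = (\<Sum>i\<in>A. \<bar>a i\<bar> powr p) powr (1 / p)"
  show ?thesis
  proof (cases "\<forall>i\<in>A. a i = 0")
    case True
    then show ?thesis by (simp add: L2_set_0')
  next
    case False
    then obtain i0 where i0: "i0 \<in> A" "a i0 \<noteq> 0" by blast
    have le: "\<bar>a i\<bar> powr p \<le> (\<Sum>i\<in>A. \<bar>a i\<bar> powr p)" if "i \<in> A" for i
      using assms(1) that by (intro member_le_sum) auto
    have pos: "0 < (\<Sum>i\<in>A. \<bar>a i\<bar> powr p)"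
      using le[OF i0(1)] i0(2) by (smt (verit) powr_gt_zero)
    have T: "0 < T" using pos by (simp add: T_def)
    have Tp: "T powr p = (\<Sum>i\<in>A. \<bar>a i\<bar> powr p)"
      using pos assms by (simp add: T_def powr_powr)
    have term_le: "(\<bar>a i\<bar> / T)\<^sup>2 \<le> (\<bar>a i\<bar> / T) powr p" if "i \<in> A" for i
    proof (cases "a i = 0")
      case False
      have "\<bar>a i\<bar> powr p \<le> T powr p" using le[OF that] Tp by simp
      then have "\<bar>a i\<bar> \<le> T" using T assms by (smt (verit) powr_less_mono2)
      then have "(\<bar>a i\<bar> / T) powr 2 \<le> (\<bar>a i\<bar> / T) powr p"
        using assms T False by (intro powr_mono') auto
      then show ?thesis using T False by (simp flip: powr_numeral)
    qed simp
    have "(\<Sum>i\<in>A. (\<bar>a i\<bar> / T)\<^sup>2) \<le> (\<Sum>i\<in>A. (\<bar>a i\<bar> / T) powr p)"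
      by (intro sum_mono term_le)
    also have "\<dots> = (\<Sum>i\<in>A. \<bar>a i\<bar> powr p) / T powr p"
      using T by (simp add: powr_divide sum_divide_distrib)
    also have "\<dots> = 1" using Tp pos by simp
    finally have "(\<Sum>i\<in>A. (a i)\<^sup>2) / T\<^sup>2 \<le> 1"
      by (simp add: power_divide sum_divide_distrib)
    then have "(\<Sum>i\<in>A. (a i)\<^sup>2) \<le> T\<^sup>2" using T by simp
    then show ?thesis using T unfolding L2_set_def T_def[symmetric] by (simp add: real_le_lsqrt)
  qed
qed

text \<open>
  The power mean inequality for the exponents \<open>2\<close> and \<open>p \<ge> 2\<close>, obtained by summing the tangent inequality
  \<open>x powr s \<ge> 1 + s * (x - 1)\<close>, with \<open>s = p / 2\<close>, over the squares divided by their mean.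
  Using a bound \<open>N\<close> in place of the cardinality lets the Gram residual, with its \<open>r * r\<close> entries,
  share the constant of an \<open>n \<times> r\<close> matrix.
\<close>
lemma L2_set_le_lp_sum_of_ge_2:
  assumes "finite A" "2 \<le> p" "real (card A) \<le> N"
  shows "L2_set a A \<le> N powr ((p - 2) / (2 * p)) * (\<Sum>i\<in>A. \<bar>a i\<bar> powr p) powr (1 / p)"
proof -
  define B where "B = (\<Sum>i\<in>A. \<bar>a i\<bar> powr p)"
  define M where "M = (\<Sum>i\<in>A. (a i)\<^sup>2) / N"
  define s where "s = p / 2"
  show ?thesis
  proof (cases "\<forall>i\<in>A. a i = 0")
    case True
    then show ?thesis by (simp add: L2_set_0')
  next
    case False
    then have ss: "0 < (\<Sum>i\<in>A. (a i)\<^sup>2)"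
      using assms(1) by (auto intro: sum_pos2)
    have "0 < card A" using assms(1) False by (auto simp: card_gt_0_iff)
    then have N: "0 < N" using assms(3) by linarith
    have M: "0 < M" using ss N by (simp add: M_def)
    have s: "1 \<le> s" using assms by (simp add: s_def)
    have bern: "s * x - (s - 1) \<le> x powr s" if "0 \<le> x" for x :: real
    proof (cases "s = 1")
      case False
      then have "1 < s" using s by simp
      then have "x * 1 \<le> x powr s / s + 1 powr (s / (s - 1)) / (s / (s - 1))"
        using that by (intro Youngs_inequality) (auto simp: field_simps)
      also have "\<dots> = (x powr s + (s - 1)) / s" using \<open>1 < s\<close> by (simp add: field_simps)
      finally show ?thesis using \<open>1 < s\<close> by (simp add: pos_le_divide_eq mult.commute)
    qed (use that in simp)
    have mean: "(\<Sum>i\<in>A. (a i)\<^sup>2 / M) = N"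
      using ss N unfolding sum_divide_distrib[symmetric] by (simp add: M_def)
    have "N \<le> N * s - (s - 1) * card A"
      using mult_left_mono[OF assms(3), of "s - 1"] s by (simp add: algebra_simps)
    also have "\<dots> = (\<Sum>i\<in>A. s * ((a i)\<^sup>2 / M) - (s - 1))"
      by (simp add: sum_subtractf mean mult.commute del: times_divide_eq_right flip: sum_distrib_left)
    also have "\<dots> \<le> (\<Sum>i\<in>A. ((a i)\<^sup>2 / M) powr s)"
      using M by (intro sum_mono bern) auto
    also have "\<dots> = (\<Sum>i\<in>A. \<bar>a i\<bar> powr p / M powr s)"
    proof (intro sum.cong refl)
      fix i assume "i \<in> A"
      have "(a i)\<^sup>2 powr s = (\<bar>a i\<bar> powr 2) powr s" by simp
      also have "\<dots> = \<bar>a i\<bar> powr p" unfolding powr_powr by (simp add: s_def)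
      finally show "((a i)\<^sup>2 / M) powr s = \<bar>a i\<bar> powr p / M powr s"
        using M by (simp add: powr_divide)
    qed
    also have "\<dots> = B / M powr s" by (simp add: B_def sum_divide_distrib)
    finally have "M powr s \<le> B / N" using M N by (simp add: field_simps)
    then have "(M powr s) powr (1 / s) \<le> (B / N) powr (1 / s)"
      using s by (intro powr_mono2) auto
    moreover have "(M powr s) powr (1 / s) = M" using M s by (simp add: powr_powr)
    moreover have B0: "0 \<le> B" by (simp add: B_def sum_nonneg)
    ultimately have "N * M \<le> N * (B powr (1 / s) / N powr (1 / s))"
      using N by (intro mult_left_mono) (auto simp: powr_divide)
    also have "\<dots> = N powr (1 - 1 / s) * B powr (1 / s)"
      using N by (simp add: powr_diff)
    also have "\<dots> = (N powr ((p - 2) / (2 * p)) * B powr (1 / p)) powr 2"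
    proof -
      have "(p - 2) / (2 * p) * 2 = 1 - 1 / s" "1 / p * 2 = 1 / s"
        using assms by (auto simp: s_def field_simps)
      then show ?thesis using N B0 by (simp add: powr_mult powr_powr del: powr_numeral)
    qed
    finally have "(\<Sum>i\<in>A. (a i)\<^sup>2) \<le> (N powr ((p - 2) / (2 * p)) * B powr (1 / p))\<^sup>2"
      using N by (simp add: M_def)
    then show ?thesis unfolding L2_set_def B_def by (simp add: real_le_lsqrt)
  qed
qed

lemma frobenius_le_entrywise_lp_norm:
  fixes Z :: "real ^ 'a ^ 'b"
  assumes "1 \<le> p" "real (CARD('b) * CARD('a)) \<le> N"
  shows "norm Z \<le> max 1 (N powr ((p - 2) / (2 * p))) * entrywise_lp_norm p Z"
proof -
  let ?a = "\<lambda>(i, j). Z $ i $ j"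
  have nz: "norm Z = L2_set ?a UNIV"
    by (simp add: norm_matrix_frobenius L2_set_def sum.cartesian_product split_beta flip: UNIV_Times_UNIV)
  have lz: "entrywise_lp_norm p Z = (\<Sum>k\<in>UNIV. \<bar>?a k\<bar> powr p) powr (1 / p)"
    by (simp add: entrywise_lp_norm_def sum.cartesian_product split_beta flip: UNIV_Times_UNIV)
  show ?thesis
  proof (cases "p \<le> 2")
    case True
    have "norm Z \<le> 1 * entrywise_lp_norm p Z"
      unfolding nz lz using L2_set_le_lp_sum_of_le_2[of UNIV p ?a] True assms by simp
    also have "\<dots> \<le> max 1 (N powr ((p - 2) / (2 * p))) * entrywise_lp_norm p Z"
      by (intro mult_right_mono) (auto simp: entrywise_lp_norm_def)
    finally show ?thesis .
  next
    case False
    have "norm Z \<le> N powr ((p - 2) / (2 * p)) * entrywise_lp_norm p Z"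
      unfolding nz lz using L2_set_le_lp_sum_of_ge_2[of UNIV p N ?a] False assms
      by (simp add: card_prod mult.commute)
    also have "\<dots> \<le> max 1 (N powr ((p - 2) / (2 * p))) * entrywise_lp_norm p Z"
      by (intro mult_right_mono) (auto simp: entrywise_lp_norm_def)
    finally show ?thesis .
  qed
qed

section \<open>Columns, Gram matrices and the nonnegative Stiefel manifold\<close>

lemma norm_eq_L2_set_column:
  fixes X :: "real ^ 'r ^ 'n"
  shows "norm X = L2_set (\<lambda>j. norm (column j X)) UNIV"
proof -
  have "(\<Sum>i\<in>UNIV. \<Sum>j\<in>UNIV. (X $ i $ j)\<^sup>2) = (\<Sum>j\<in>UNIV. (norm (column j X))\<^sup>2)"
    by (subst sum.swap) (simp add: norm_vec_def L2_set_def column_def sum_nonneg)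
  then show ?thesis by (simp add: norm_matrix_frobenius L2_set_def)
qed

lemma gram_nth: "(transpose X ** X) $ j $ k = column j X \<bullet> column k X"
  for X :: "real ^ 'r ^ 'n"
  by (simp add: matrix_matrix_mult_def transpose_def column_def inner_vec_def)

lemma sum_abs_le_sqrt_card_norm: "(\<Sum>k\<in>UNIV. \<bar>v $ k\<bar>) \<le> sqrt CARD('k) * norm v"
  for v :: "real ^ 'k"
  using L2_set_mult_ineq[of "\<lambda>k. v $ k" "\<lambda>_. 1" UNIV]
  by (simp add: L2_set_constant norm_vec_def L2_set_def mult.commute)

lemma sum_norm_column_le: "(\<Sum>k\<in>UNIV. norm (column k X)) \<le> sqrt CARD('r) * norm X"
  for X :: "real ^ 'r ^ 'n"
  using L2_set_mult_ineq[of "\<lambda>k. norm (column k X)" "\<lambda>_. 1" UNIV]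
  by (simp add: L2_set_constant norm_eq_L2_set_column mult.commute)

lemma norm_column_le: "norm (column j X) \<le> norm X" for X :: "real ^ 'r ^ 'n"
  using member_le_L2_set[of UNIV j "\<lambda>j. norm (column j X)"] by (simp add: norm_eq_L2_set_column)

lemma abs_matrix_entry_le: "\<bar>D $ j $ k\<bar> \<le> norm D" for D :: "real ^ 'r ^ 'n"
  by (rule order_trans[OF component_le_norm_cart Finite_Cartesian_Product.norm_nth_le])

text \<open>
  The sum of the columns is \<open>X\<close> applied to the all-ones vector, so this stands in for the
  bound \<open>sqrt (1 + \<delta>)\<close> on the operator norm of \<open>X\<close>, where \<open>\<delta>\<close> is the norm of the Gram residual.
  The Frobenius norm of \<open>X\<close> would bound the sum only by a multiple of \<open>CARD('r)\<close>, not of its square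
  root.
\<close>
lemma norm_sum_columns_le:
  fixes X :: "real ^ 'r ^ 'n"
  shows "(norm (\<Sum>k\<in>UNIV. column k X))\<^sup>2 \<le> real CARD('r) * (1 + norm (transpose X ** X - mat 1))"
proof -
  define D where "D = transpose X ** X - mat 1"
  have "(norm (\<Sum>k\<in>UNIV. column k X))\<^sup>2 = (\<Sum>j\<in>UNIV. \<Sum>k\<in>UNIV. column j X \<bullet> column k X)"
    by (simp add: power2_norm_eq_inner inner_sum_left inner_sum_right inner_commute)
  also have "\<dots> = (\<Sum>j\<in>(UNIV :: 'r set). 1 + (\<Sum>k\<in>UNIV. D $ j $ k))"
    by (simp add: D_def gram_nth mat_def sum_subtractf)
  also have "\<dots> \<le> (\<Sum>j\<in>(UNIV :: 'r set). 1 + sqrt CARD('r) * norm (D $ j))"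
  proof (intro sum_mono add_left_mono)
    fix j :: 'r
    have "(\<Sum>k\<in>UNIV. D $ j $ k) \<le> (\<Sum>k\<in>UNIV. \<bar>D $ j $ k\<bar>)" by (intro sum_mono) simp
    also have "\<dots> \<le> sqrt CARD('r) * norm (D $ j)" by (rule sum_abs_le_sqrt_card_norm)
    finally show "(\<Sum>k\<in>UNIV. D $ j $ k) \<le> sqrt CARD('r) * norm (D $ j)" .
  qed
  also have "\<dots> = CARD('r) + sqrt CARD('r) * (\<Sum>j\<in>UNIV. norm (D $ j))"
    by (simp add: sum.distrib sum_distrib_left)
  also have "\<dots> \<le> CARD('r) + sqrt CARD('r) * (sqrt CARD('r) * norm D)"
    using L2_set_mult_ineq[of "\<lambda>k. norm (D $ k)" "\<lambda>_. 1" UNIV]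
    by (intro add_left_mono mult_left_mono) (auto simp: L2_set_constant norm_vec_def mult.commute)
  also have "\<dots> = CARD('r) * (1 + norm D)" by (simp add: algebra_simps)
  finally show ?thesis by (simp add: D_def)
qed

lemma norm_le_gram_defect:
  fixes X :: "real ^ 'r ^ 'n"
  shows "norm X \<le> sqrt CARD('r) + sqrt (sqrt CARD('r) * norm (transpose X ** X - mat 1))"
proof -
  define D where "D = transpose X ** X - mat 1"
  have "(norm X)\<^sup>2 = (\<Sum>j\<in>UNIV. column j X \<bullet> column j X)"
    by (simp add: norm_eq_L2_set_column L2_set_def sum_nonneg power2_norm_eq_inner)
  also have "\<dots> = (\<Sum>j\<in>(UNIV :: 'r set). 1 + D $ j $ j)"
    by (intro sum.cong) (simp_all add: D_def gram_nth mat_def)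
  also have "\<dots> \<le> (\<Sum>j\<in>(UNIV :: 'r set). 1 + norm (D $ j))"
    by (intro sum_mono add_left_mono) (metis abs_le_D1 component_le_norm_cart)
  also have "\<dots> = CARD('r) + (\<Sum>j\<in>UNIV. norm (D $ j))" by (simp add: sum.distrib)
  also have "\<dots> \<le> CARD('r) + sqrt CARD('r) * norm D"
    using L2_set_mult_ineq[of "\<lambda>k. norm (D $ k)" "\<lambda>_. 1" UNIV]
    by (intro add_left_mono) (auto simp: L2_set_constant norm_vec_def mult.commute)
  finally have "norm X \<le> sqrt (CARD('r) + sqrt CARD('r) * norm D)" by (rule real_le_rsqrt)
  also have "\<dots> \<le> sqrt CARD('r) + sqrt (sqrt CARD('r) * norm D)"
    by (rule sqrt_add_le_add_sqrt) auto
  finally show ?thesis by (simp add: D_def)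
qed

lemma nonneg_stiefel_iff:
  "W \<in> nonneg_stiefel \<longleftrightarrow>
    (\<forall>j k. column j W \<bullet> column k W = (if j = k then 1 else 0)) \<and> (\<forall>i j. 0 \<le> W $ i $ j)"
  for W :: "real ^ 'r ^ 'n"
  by (auto simp: nonneg_stiefel_def vec_eq_iff gram_nth mat_def)

lemma norm_nonneg_stiefel: "norm W = sqrt CARD('r)"
  if "W \<in> nonneg_stiefel" for W :: "real ^ 'r ^ 'n"
proof -
  have "norm (column j W) = 1" for j
    using that by (simp add: nonneg_stiefel_iff norm_eq_sqrt_inner)
  then show ?thesis by (simp add: norm_eq_L2_set_column L2_set_constant)
qed

lemma nonneg_stiefel_nonempty:
  assumes "CARD('r) \<le> CARD('n)"
  shows "(nonneg_stiefel :: (real ^ 'r ^ 'n) set) \<noteq> {}"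
proof -
  obtain f :: "'r \<Rightarrow> 'n" where f: "inj f"
    using card_le_inj[of "UNIV :: 'r set" "UNIV :: 'n set"] assms by auto
  define W :: "real ^ 'r ^ 'n" where "W = (\<chi> i j. if i = f j then 1 else 0)"
  have "column j W = axis (f j) 1" for j
    by (simp add: column_def W_def axis_def vec_eq_iff)
  then have "W \<in> nonneg_stiefel"
    using f by (auto simp: nonneg_stiefel_iff inner_axis_axis W_def inj_eq)
  then show ?thesis by blast
qed

section \<open>Rounding a nonnegative matrix to the manifold\<close>

text \<open>
  Columns with disjoint supports are already orthogonal, so it suffices to normalize them.
\<close>
lemma exists_nonneg_stiefel_near_disjoint_columns:
  fixes Z :: "real ^ 'r ^ 'n"
  assumes nonneg: "\<And>i j. 0 \<le> Z $ i $ j"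
    and disjoint: "\<And>i j k. j \<noteq> k \<Longrightarrow> Z $ i $ j = 0 \<or> Z $ i $ k = 0"
    and nonzero: "\<And>j. column j Z \<noteq> 0"
  shows "\<exists>W\<in>nonneg_stiefel. \<forall>j. norm (column j Z - column j W) = \<bar>norm (column j Z) - 1\<bar>"
proof -
  define W :: "real ^ 'r ^ 'n" where "W = (\<chi> i j. Z $ i $ j / norm (column j Z))"
  have W: "column j W = (1 / norm (column j Z)) *\<^sub>R column j Z" for j
    by (simp add: W_def column_def vec_eq_iff)
  have orth: "column j Z \<bullet> column k Z = 0" if "j \<noteq> k" for j k
    using disjoint[OF that] by (auto simp: inner_vec_def column_def intro!: sum.neutral)
  have "0 \<le> W $ i $ j" for i j using nonneg by (simp add: W_def)
  moreover have "column j W \<bullet> column k W = (if j = k then 1 else 0)" for j k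
    using orth nonzero by (simp add: W dot_square_norm power2_eq_square)
  ultimately have "W \<in> nonneg_stiefel" by (simp add: nonneg_stiefel_iff)
  moreover have "norm (column j Z - column j W) = \<bar>norm (column j Z) - 1\<bar>" for j
  proof -
    have "column j Z - column j W = (1 - 1 / norm (column j Z)) *\<^sub>R column j Z"
      by (simp add: W scaleR_left_diff_distrib)
    then have "norm (column j Z - column j W) = \<bar>(1 - 1 / norm (column j Z)) * norm (column j Z)\<bar>"
      by (simp add: abs_mult)
    also have "(1 - 1 / norm (column j Z)) * norm (column j Z) = norm (column j Z) - 1"
      using nonzero[of j] by (simp add: field_simps)
    finally show ?thesis .
  qed
  ultimately show ?thesis by blast
qed

text \<open>
  For \<open>Y \<ge> 0\<close> this is the sum of the inner products of column \<open>j\<close> with the other columns.  It vanishes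
  for all \<open>j\<close> exactly when the columns have disjoint supports.
\<close>
definition column_overlap :: "real ^ 'r ^ 'n \<Rightarrow> 'r \<Rightarrow> real" where
  "column_overlap Y j = column j Y \<bullet> (\<Sum>k\<in>UNIV. column k Y) - column j Y \<bullet> column j Y"

text \<open>
  Rounding keeps one largest entry in each row and normalizes the columns that remain.  A dropped
  entry \<open>Y $ i $ j\<close> is at most the kept entry of its row, so its square is at most its product with
  the rest of the row; summed over \<open>i\<close> this is at most the overlap of column \<open>j\<close>.  The hypothesis on
  the overlap ensures that no column is dropped entirely.  The dropped mass is paid for twice: once
  for leaving \<open>Y\<close>, once because the column to be normalized has become shorter.
\<close>
lemma exists_nonneg_stiefel_near_small_overlap:
  fixes Y :: "real ^ 'r ^ 'n"
  assumes nonneg: "\<And>i j. 0 \<le> Y $ i $ j"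
    and overlap: "\<And>j. column_overlap Y j < (norm (column j Y))\<^sup>2"
  shows "\<exists>W\<in>nonneg_stiefel. \<forall>j. norm (column j Y - column j W)
           \<le> 2 * sqrt (column_overlap Y j) + \<bar>norm (column j Y) - 1\<bar>"
proof -
  have "\<exists>m. \<forall>j. Y $ i $ j \<le> Y $ i $ m" for i
  proof -
    have "finite (range (\<lambda>j. Y $ i $ j))" "range (\<lambda>j. Y $ i $ j) \<noteq> {}" by auto
    then obtain m where "Y $ i $ m = Max (range (\<lambda>j. Y $ i $ j))"
      using Max_in by (metis (no_types, lifting) imageE)
    then show ?thesis by (metis Max_ge \<open>finite (range (\<lambda>j. Y $ i $ j))\<close> rangeI)
  qed
  then obtain m where m: "\<And>i j. Y $ i $ j \<le> Y $ i $ m i" by metis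
  define Z :: "real ^ 'r ^ 'n" where "Z = (\<chi> i j. if j = m i then Y $ i $ j else 0)"
  have dropped: "norm (column j Y - column j Z) \<le> sqrt (column_overlap Y j)" for j
  proof -
    have "(norm (column j Y - column j Z))\<^sup>2 = (\<Sum>i\<in>UNIV. (Y $ i $ j - Z $ i $ j)\<^sup>2)"
      by (simp add: norm_vec_def L2_set_def column_def sum_nonneg)
    also have "\<dots> \<le> (\<Sum>i\<in>UNIV. Y $ i $ j * (\<Sum>k\<in>UNIV. Y $ i $ k) - Y $ i $ j * Y $ i $ j)"
    proof (rule sum_mono)
      fix i
      have split: "(\<Sum>k\<in>UNIV. Y $ i $ k) - Y $ i $ j = (\<Sum>k\<in>UNIV - {j}. Y $ i $ k)"
        by (simp add: sum_diff1)
      \<comment> \<open>A dropped entry is dominated by the kept one, which occurs in the sum on the right.\<close>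
      have "\<bar>Y $ i $ j - Z $ i $ j\<bar> \<le> (\<Sum>k\<in>UNIV - {j}. Y $ i $ k)"
      proof (cases "j = m i")
        case True
        then show ?thesis using nonneg by (simp add: Z_def sum_nonneg)
      next
        case False
        then have "Y $ i $ m i \<le> (\<Sum>k\<in>UNIV - {j}. Y $ i $ k)"
          using nonneg by (intro member_le_sum) auto
        then show ?thesis using m[of i j] nonneg[of i j] False by (simp add: Z_def)
      qed
      moreover have "\<bar>Y $ i $ j - Z $ i $ j\<bar> \<le> Y $ i $ j"
        using nonneg[of i j] nonneg[of i "m i"] by (simp add: Z_def)
      ultimately have "\<bar>Y $ i $ j - Z $ i $ j\<bar> * \<bar>Y $ i $ j - Z $ i $ j\<bar>
          \<le> Y $ i $ j * (\<Sum>k\<in>UNIV - {j}. Y $ i $ k)"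
        by (intro mult_mono) (auto simp: nonneg)
      then show "(Y $ i $ j - Z $ i $ j)\<^sup>2
          \<le> Y $ i $ j * (\<Sum>k\<in>UNIV. Y $ i $ k) - Y $ i $ j * Y $ i $ j"
        by (simp add: power2_eq_square right_diff_distrib split flip: abs_mult)
          (simp add: right_diff_distrib flip: split)
    qed
    also have "\<dots> = column_overlap Y j"
      by (simp add: column_overlap_def inner_vec_def column_def sum_subtractf)
    finally show ?thesis by (rule real_le_rsqrt)
  qed
  have "\<exists>W\<in>nonneg_stiefel. \<forall>j. norm (column j Z - column j W) = \<bar>norm (column j Z) - 1\<bar>"
  proof (rule exists_nonneg_stiefel_near_disjoint_columns)
    show "column j Z \<noteq> 0" for j
    proof
      assume "column j Z = 0"
      then have "norm (column j Y) \<le> sqrt (column_overlap Y j)" using dropped[of j] by simp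
      then have "(norm (column j Y))\<^sup>2 \<le> column_overlap Y j"
        using real_sqrt_le_iff by fastforce
      then show False using overlap[of j] by simp
    qed
  qed (auto simp: Z_def nonneg)
  then obtain W where W: "W \<in> nonneg_stiefel"
    and ZW: "\<And>j. norm (column j Z - column j W) = \<bar>norm (column j Z) - 1\<bar>" by blast
  have "norm (column j Y - column j W)
      \<le> 2 * sqrt (column_overlap Y j) + \<bar>norm (column j Y) - 1\<bar>" for j
    using ZW[of j] dropped[of j] norm_triangle_ineq3[of "column j Y" "column j Z"]
      norm_triangle_ineq[of "column j Y - column j Z" "column j Z - column j W"]
    by simp
  then show ?thesis using W by blast
qed

section \<open>The error bound in the Frobenius norm\<close>

lemma column_pos_part:
  fixes X :: "real ^ 'r ^ 'n"
  shows "0 \<le> (X + neg_part_matrix X) $ i $ j"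
    and "(norm (column j (X + neg_part_matrix X)))\<^sup>2
          = (norm (column j X))\<^sup>2 - (norm (column j (neg_part_matrix X)))\<^sup>2"
proof -
  show "0 \<le> (X + neg_part_matrix X) $ i $ j" by (simp add: neg_part_matrix_def)
  have "(X $ i $ j + max (- X $ i $ j) 0)\<^sup>2 = (X $ i $ j)\<^sup>2 - (max (- X $ i $ j) 0)\<^sup>2" for i
    by (simp add: max_def)
  then show "(norm (column j (X + neg_part_matrix X)))\<^sup>2
          = (norm (column j X))\<^sup>2 - (norm (column j (neg_part_matrix X)))\<^sup>2"
    by (simp add: power2_norm_eq_inner inner_vec_def column_def neg_part_matrix_def sum_subtractf
        flip: power2_eq_square)
qed

text \<open>
  Let \<open>x\<close>, \<open>m\<close> be column \<open>j\<close> of \<open>X\<close> and of its negative part, and \<open>s\<close>, \<open>t\<close> the sums of all columns of these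
  two matrices.  Column \<open>j\<close> of the positive part is \<open>x + m\<close>, hence its overlap is the off-diagonal row
  sum \<open>x \<bullet> s - x \<bullet> x\<close> of the Gram residual plus terms that contain a factor from the negative part.
  The constant is \<open>11 / 4 = 2 * 9 / 8 + 1 / 4 + 1 / 4\<close>: the factor \<open>9 / 8 \<ge> sqrt (1 + 1 / 4)\<close> comes
  from each of \<open>x \<bullet> t\<close> and \<open>m \<bullet> s\<close>, and \<open>1 / 4\<close> from each of \<open>m \<bullet> t\<close> and \<open>m \<bullet> m\<close>.
\<close>
lemma column_overlap_pos_part_le:
  fixes X :: "real ^ 'r ^ 'n"
  defines "\<epsilon> \<equiv> norm (neg_part_matrix X)" and "\<delta> \<equiv> norm (transpose X ** X - mat 1)"
  assumes "\<epsilon> \<le> 1 / 4" "\<delta> \<le> 1 / 4"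
  shows "column_overlap (X + neg_part_matrix X) j \<le> sqrt CARD('r) * (\<delta> + 11 / 4 * \<epsilon>)"
proof -
  define M where "M = neg_part_matrix X"
  define D where "D = transpose X ** X - mat 1"
  define R where "R = sqrt CARD('r)"
  define x where "x = column j X"
  define m where "m = column j M"
  define s where "s = (\<Sum>k\<in>UNIV. column k X)"
  define t where "t = (\<Sum>k\<in>UNIV. column k M)"
  have R: "0 \<le> R" by (simp add: R_def)
  have \<epsilon>: "0 \<le> \<epsilon>" by (simp add: \<epsilon>_def)
  have m: "norm m \<le> \<epsilon>" unfolding m_def \<epsilon>_def M_def by (rule norm_column_le)
  have "norm t \<le> (\<Sum>k\<in>UNIV. norm (column k M))" unfolding t_def by (rule norm_sum)
  then have t: "norm t \<le> R * \<epsilon>"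
    using sum_norm_column_le[of M] by (simp add: R_def \<epsilon>_def M_def)
  have "(norm s)\<^sup>2 \<le> real CARD('r) * (1 + \<delta>)"
    unfolding s_def \<delta>_def by (rule norm_sum_columns_le)
  also have "\<dots> \<le> real CARD('r) * (9 / 8)\<^sup>2"
    using assms(4) by (intro mult_left_mono) (auto simp: power2_eq_square)
  also have "\<dots> = (R * (9 / 8))\<^sup>2" unfolding R_def power_mult_distrib by simp
  finally have s: "norm s \<le> R * (9 / 8)" by (rule power2_le_imp_le) (use R in simp)
  have "\<bar>D $ j $ j\<bar> \<le> \<delta>" unfolding \<delta>_def D_def by (rule abs_matrix_entry_le)
  then have "1 + D $ j $ j \<le> (9 / 8)\<^sup>2" using assms(4) by (simp add: power2_eq_square)
  moreover have "(norm x)\<^sup>2 = 1 + D $ j $ j"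
    by (simp add: x_def D_def gram_nth mat_def power2_norm_eq_inner)
  ultimately have "(norm x)\<^sup>2 \<le> (9 / 8)\<^sup>2" by simp
  then have x: "norm x \<le> 9 / 8" by (rule power2_le_imp_le) simp
  have "x \<bullet> s - x \<bullet> x = (\<Sum>k\<in>UNIV - {j}. D $ j $ k)"
  proof -
    have "x \<bullet> s - x \<bullet> x = (\<Sum>k\<in>UNIV - {j}. x \<bullet> column k X)"
      by (simp add: s_def inner_sum_right sum_diff1 x_def)
    also have "\<dots> = (\<Sum>k\<in>UNIV - {j}. D $ j $ k)"
      by (intro sum.cong) (auto simp: D_def gram_nth mat_def x_def)
    finally show ?thesis .
  qed
  also have "\<dots> \<le> (\<Sum>k\<in>UNIV - {j}. \<bar>D $ j $ k\<bar>)" by (intro sum_mono) simp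
  also have "\<dots> \<le> (\<Sum>k\<in>UNIV. \<bar>D $ j $ k\<bar>)" by (intro sum_mono2) auto
  also have "\<dots> \<le> R * norm (D $ j)" unfolding R_def by (rule sum_abs_le_sqrt_card_norm)
  also have "\<dots> \<le> R * \<delta>"
    unfolding \<delta>_def D_def[symmetric] by (rule mult_left_mono[OF Finite_Cartesian_Product.norm_nth_le R])
  finally have xs: "x \<bullet> s - x \<bullet> x \<le> R * \<delta>" .
  have xt: "x \<bullet> t \<le> 9 / 8 * (R * \<epsilon>)"
    using norm_cauchy_schwarz[of x t] mult_mono[OF x t] by simp
  have ms: "m \<bullet> s \<le> 9 / 8 * (R * \<epsilon>)"
    using norm_cauchy_schwarz[of m s] mult_mono[OF m s] \<epsilon> by (simp add: mult_ac)
  have mt: "m \<bullet> t \<le> \<epsilon> * (R * \<epsilon>)"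
    using norm_cauchy_schwarz[of m t] mult_mono[OF m t] \<epsilon> by simp
  have quad: "\<epsilon> * \<epsilon> \<le> \<epsilon> / 4" using assms(3) \<epsilon> mult_left_mono[of \<epsilon> "1 / 4" \<epsilon>] by simp
  have mm: "m \<bullet> m \<le> \<epsilon> / 4"
    using mult_mono[OF m m] \<epsilon> quad by (simp add: power2_norm_eq_inner[symmetric] power2_eq_square)
  have "1 \<le> CARD('r)" by (simp add: Suc_leI)
  then have "1 \<le> R" unfolding R_def by simp
  then have R\<epsilon>: "\<epsilon> \<le> R * \<epsilon>" using \<epsilon> mult_right_mono[of 1 R \<epsilon>] by simp
  have quadR: "\<epsilon> * (R * \<epsilon>) \<le> 1 / 4 * (R * \<epsilon>)"
    using mult_left_mono[OF quad R] by (simp add: algebra_simps)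
  have col: "column k (X + M) = column k X + column k M" for k
    by (simp add: column_def vec_eq_iff)
  have "(x + m) \<bullet> (x + m) = x \<bullet> x - m \<bullet> m"
    using column_pos_part(2)[of j X]
    by (simp add: power2_norm_eq_inner col[unfolded M_def] x_def m_def M_def)
  then have "column_overlap (X + M) j = (x + m) \<bullet> (s + t) - (x \<bullet> x - m \<bullet> m)"
    by (simp add: column_overlap_def col sum.distrib x_def m_def s_def t_def)
  also have "\<dots> = (x \<bullet> s - x \<bullet> x) + x \<bullet> t + m \<bullet> s + m \<bullet> t + m \<bullet> m"
    by (simp add: inner_add_left inner_add_right)
  also have "\<dots> \<le> R * \<delta> + 11 / 4 * (R * \<epsilon>)"
    using xs xt ms mt mm quadR R\<epsilon> \<epsilon> by linarith
  finally show ?thesis by (simp add: M_def R_def algebra_simps)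
qed

text \<open>
  All powers of \<open>r\<close> in the error bound become integer powers of its fourth root, which turns the
  final estimates into polynomial ones.
\<close>
lemma powers_of_fourth_root:
  fixes r :: real
  assumes "1 \<le> r"
  shows "1 \<le> r powr (1 / 4)" "sqrt r = (r powr (1 / 4)) ^ 2" "r powr (3 / 4) = (r powr (1 / 4)) ^ 3"
  using assms by (auto simp: ge_one_powr_ge_zero powr_half_sqrt[symmetric] powr_powr simp flip: powr_numeral)

text \<open>
  When the residual is not small, any point of the manifold is close enough, because \<open>norm X\<close> is
  controlled by the Gram residual alone.  The parameter \<open>a\<close> is \<open>sqrt (norm (neg_part_matrix X))\<close> in
  one use; in the other it is 1, when only a lower bound on the negative part is available.
\<close>
lemma dist_nonneg_stiefel_le_large_residual:
  fixes X W :: "real ^ 'r ^ 'n"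
  assumes "W \<in> nonneg_stiefel" and a: "0 \<le> a"
    and big: "1 / (2 * real CARD('r) powr (1 / 4)) \<le> a + sqrt (norm (transpose X ** X - mat 1))"
  shows "dist X W \<le> 5 * real CARD('r) powr (3 / 4) * (a + sqrt (norm (transpose X ** X - mat 1)))"
proof -
  define h where "h = real CARD('r) powr (1 / 4)"
  define d where "d = sqrt (norm (transpose X ** X - mat 1))"
  have "1 \<le> CARD('r)" by (simp add: Suc_leI)
  then have h: "1 \<le> h" and sq: "sqrt CARD('r) = h ^ 2" and cube: "real CARD('r) powr (3 / 4) = h ^ 3"
    using powers_of_fourth_root[of "real CARD('r)"] by (simp_all add: h_def)
  have d: "0 \<le> d" by (simp add: d_def)
  have "dist X W \<le> norm X + norm W" unfolding dist_norm by (rule norm_triangle_ineq4)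
  also have "\<dots> \<le> (h ^ 2 + h * d) + h ^ 2"
    using norm_le_gram_defect[of X] norm_nonneg_stiefel[OF assms(1)] h
    by (simp add: sq real_sqrt_mult d_def)
  finally have dist: "dist X W \<le> 2 * h ^ 2 + h * d" by simp
  have "4 * h ^ 3 * (1 / (2 * h)) \<le> 4 * h ^ 3 * (a + d)"
    using big h by (intro mult_left_mono) (auto simp: h_def d_def)
  moreover have "4 * h ^ 3 * (1 / (2 * h)) = 2 * h ^ 2"
    using h by (simp add: power3_eq_cube power2_eq_square)
  moreover have "h * d \<le> h ^ 3 * (a + d)"
    using h d a power_increasing[of 1 3 h] by (intro mult_mono) auto
  ultimately have "2 * h ^ 2 + h * d \<le> 5 * h ^ 3 * (a + d)" by (simp add: algebra_simps)
  then show ?thesis using dist by (simp add: cube d_def)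
qed

lemma L2_set_triangle3:
  "L2_set (\<lambda>i. f i + g i + h i) A \<le> L2_set f A + L2_set g A + L2_set h A"
  using L2_set_triangle_ineq[of "\<lambda>i. f i + g i" h A] L2_set_triangle_ineq[of f g A] by linarith

text \<open>
  The residual is small enough for every overlap to be at most \<open>11 / 16\<close>, whereas the squared column
  norms of the positive part are at least \<open>3 / 4\<close>; so the positive part can be rounded.  Passing from
  \<open>X\<close> to the rounded matrix costs, in column \<open>j\<close>, twice the negative part, twice the square root of
  the overlap, and the deviation of \<open>norm (column j X)\<close> from 1.  The overlap bound is the same for all
  columns and so gains a factor \<open>sqrt CARD('r)\<close> in the \<open>\<ell>\<^sub>2\<close>-sum; together with its own factor
  \<open>CARD('r) powr (1 / 4)\<close> this gives the exponent \<open>3 / 4\<close>.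
\<close>
lemma exists_nonneg_stiefel_near_small_residual:
  fixes X :: "real ^ 'r ^ 'n"
  defines "\<epsilon> \<equiv> norm (neg_part_matrix X)" and "\<delta> \<equiv> norm (transpose X ** X - mat 1)"
  assumes small: "sqrt \<epsilon> + sqrt \<delta> < 1 / (2 * real CARD('r) powr (1 / 4))"
  shows "\<exists>W\<in>nonneg_stiefel. dist X W \<le> 5 * real CARD('r) powr (3 / 4) * (sqrt \<epsilon> + sqrt \<delta>)"
proof -
  define M where "M = neg_part_matrix X"
  define D where "D = transpose X ** X - mat 1"
  define Y where "Y = X + M"
  define h where "h = real CARD('r) powr (1 / 4)"
  define e where "e = sqrt \<epsilon>"
  define d where "d = sqrt \<delta>"
  have "1 \<le> CARD('r)" by (simp add: Suc_leI)
  then have h: "1 \<le> h" and sq: "sqrt CARD('r) = h ^ 2" and cube: "real CARD('r) powr (3 / 4) = h ^ 3"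
    using powers_of_fourth_root[of "real CARD('r)"] by (simp_all add: h_def)
  have ed: "0 \<le> e" "0 \<le> d" and \<epsilon>: "\<epsilon> = e ^ 2" and \<delta>: "\<delta> = d ^ 2"
    by (simp_all add: e_def d_def \<epsilon>_def \<delta>_def)
  have hed: "h * (e + d) \<le> 1 / 2"
    using small h by (simp add: e_def d_def h_def field_simps)
  have "1 * (e + d) \<le> h * (e + d)" using h ed by (intro mult_right_mono) auto
  then have half: "e + d \<le> 1 / 2" using order_trans hed by fastforce
  have "(h * (e + d))\<^sup>2 \<le> (1 / 2)\<^sup>2"
    using hed h ed by (intro power_mono) auto
  then have quarter: "h ^ 2 * (e + d)\<^sup>2 \<le> 1 / 4"
    unfolding power_mult_distrib by (simp add: power_divide)
  have "e\<^sup>2 + d\<^sup>2 \<le> (e + d)\<^sup>2" using ed by (simp add: power2_sum)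
  moreover have "1 * (e + d)\<^sup>2 \<le> h ^ 2 * (e + d)\<^sup>2"
    using h by (intro mult_right_mono) auto
  ultimately have sum_le: "\<epsilon> + \<delta> \<le> 1 / 4" and hsum_le: "h ^ 2 * (\<epsilon> + \<delta>) \<le> 1 / 4"
    using quarter mult_left_mono[of "e\<^sup>2 + d\<^sup>2" "(e + d)\<^sup>2" "h ^ 2"] by (auto simp: \<epsilon> \<delta>)
  have nn: "0 \<le> \<epsilon>" "0 \<le> \<delta>" by (simp_all add: \<epsilon> \<delta>)
  define B where "B = h ^ 2 * (\<delta> + 11 / 4 * \<epsilon>)"
  have B0: "0 \<le> B" using nn by (simp add: B_def)
  have overlap: "column_overlap Y j \<le> B" for j
  proof -
    have "\<epsilon> \<le> 1 / 4" "\<delta> \<le> 1 / 4" using sum_le nn by linarith+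
    then show ?thesis
      using column_overlap_pos_part_le[of X j] by (simp add: B_def Y_def M_def sq \<epsilon>_def \<delta>_def)
  qed
  have colX: "(norm (column j X))\<^sup>2 = 1 + D $ j $ j" for j
    by (simp add: D_def gram_nth mat_def power2_norm_eq_inner)
  have Y_large: "column_overlap Y j < (norm (column j Y))\<^sup>2" for j
  proof -
    have "B \<le> 11 / 4 * (h ^ 2 * (\<epsilon> + \<delta>))" using nn by (simp add: B_def algebra_simps)
    then have "B \<le> 11 / 16" using hsum_le by linarith
    moreover have "(norm (column j M))\<^sup>2 \<le> \<epsilon>"
    proof -
      have "norm (column j M) * norm (column j M) \<le> \<epsilon> * 1"
        using norm_column_le[of j M] sum_le nn by (intro mult_mono) (auto simp: \<epsilon>_def M_def)
      then show ?thesis by (simp add: power2_eq_square)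
    qed
    moreover have "\<bar>D $ j $ j\<bar> \<le> \<delta>" using abs_matrix_entry_le[of D j j] by (simp add: D_def \<delta>_def)
    ultimately show ?thesis
      using column_pos_part(2)[of j X] colX[of j] overlap[of j] sum_le
      unfolding Y_def M_def by linarith
  qed
  have "\<exists>W\<in>nonneg_stiefel. \<forall>j. norm (column j Y - column j W)
           \<le> 2 * sqrt (column_overlap Y j) + \<bar>norm (column j Y) - 1\<bar>"
    using column_pos_part(1) Y_large
    by (intro exists_nonneg_stiefel_near_small_overlap) (auto simp only: Y_def M_def)
  then obtain W where W: "W \<in> nonneg_stiefel"
    and YW: "\<And>j. norm (column j Y - column j W)
               \<le> 2 * sqrt (column_overlap Y j) + \<bar>norm (column j Y) - 1\<bar>" by blast
  have col: "norm (column j (X - W)) \<le> 2 * norm (column j M) + 2 * sqrt B + norm (D $ j)" for j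
  proof -
    have XY: "column j Y - column j X = column j M" and XW: "column j (X - W) = column j X - column j W"
      by (simp_all add: Y_def column_def vec_eq_iff)
    have "\<bar>norm (column j X) - 1\<bar> \<le> \<bar>norm (column j X) - 1\<bar> * (norm (column j X) + 1)"
      by (simp add: mult_le_cancel_left1)
    also have "\<dots> = \<bar>(norm (column j X) - 1) * (norm (column j X) + 1)\<bar>"
      by (simp add: abs_mult)
    also have "(norm (column j X) - 1) * (norm (column j X) + 1) = D $ j $ j"
      using colX[of j] by (simp add: power2_eq_square algebra_simps)
    also have "\<bar>D $ j $ j\<bar> \<le> norm (D $ j)" by (rule component_le_norm_cart)
    finally have unit: "\<bar>norm (column j X) - 1\<bar> \<le> norm (D $ j)" .
    have "sqrt (column_overlap Y j) \<le> sqrt B" using overlap by simp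
    moreover have "\<bar>norm (column j Y) - norm (column j X)\<bar> \<le> norm (column j M)"
      using norm_triangle_ineq3[of "column j Y" "column j X"] XY by simp
    moreover have "norm (column j (X - W)) \<le> norm (column j M) + norm (column j Y - column j W)"
      using norm_triangle_ineq[of "column j X - column j Y" "column j Y - column j W"]
      by (simp add: XW norm_minus_commute[of "column j X" "column j Y"] XY)
    ultimately show ?thesis using YW[of j] unit by linarith
  qed
  have "dist X W \<le> L2_set (\<lambda>j. 2 * norm (column j M) + 2 * sqrt B + norm (D $ j)) UNIV"
    unfolding dist_norm norm_eq_L2_set_column by (intro L2_set_mono col) simp
  also have "\<dots> \<le> L2_set (\<lambda>j. 2 * norm (column j M)) UNIV
      + L2_set (\<lambda>_. 2 * sqrt B) (UNIV :: 'r set) + L2_set (\<lambda>j. norm (D $ j)) UNIV"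
    by (rule L2_set_triangle3)
  also have "\<dots> = 2 * \<epsilon> + h ^ 2 * (2 * sqrt B) + \<delta>"
    using B0 by (simp add: L2_set_right_distrib[symmetric] norm_eq_L2_set_column[symmetric]
        L2_set_constant sq \<epsilon>_def M_def \<delta>_def D_def norm_vec_def[of "transpose X ** X - mat 1"])
  finally have dist: "dist X W \<le> 2 * \<epsilon> + 2 * (h ^ 2 * sqrt B) + \<delta>" by simp
  \<comment> \<open>\<open>5 / 3\<close> bounds \<open>sqrt (11 / 4)\<close>; the final coefficient of \<open>e\<close> is then \<open>1 + 10 / 3 \<le> 5\<close>.\<close>
  have "sqrt B \<le> h * (d + 5 / 3 * e)"
  proof (rule real_le_lsqrt)
    have "(d + 5 / 3 * e)\<^sup>2 = d\<^sup>2 + 11 / 4 * e\<^sup>2 + (1 / 36 * e\<^sup>2 + 10 / 3 * (d * e))"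
      by (simp add: power2_eq_square algebra_simps)
    moreover have "0 \<le> 1 / 36 * e\<^sup>2 + 10 / 3 * (d * e)" using ed by simp
    ultimately have "d\<^sup>2 + 11 / 4 * e\<^sup>2 \<le> (d + 5 / 3 * e)\<^sup>2" by linarith
    then show "B \<le> (h * (d + 5 / 3 * e))\<^sup>2"
      by (simp add: B_def \<epsilon> \<delta> power_mult_distrib mult_left_mono)
  qed (use h ed in simp)
  then have "h ^ 2 * sqrt B \<le> h ^ 2 * (h * (d + 5 / 3 * e))" by (intro mult_left_mono) auto
  then have main: "h ^ 2 * sqrt B \<le> h ^ 3 * (d + 5 / 3 * e)"
    by (simp add: power3_eq_cube power2_eq_square mult.assoc)
  have h3: "1 \<le> h ^ 3" using h by simp
  have "\<epsilon> \<le> 1 / 2 * e" "\<delta> \<le> 1 / 2 * d"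
    using mult_right_mono[of e "1 / 2" e] mult_right_mono[of d "1 / 2" d] half ed
    by (simp_all add: \<epsilon> \<delta> power2_eq_square)
  moreover have "e \<le> h ^ 3 * e" "d \<le> h ^ 3 * d"
    using mult_right_mono[OF h3 ed(1)] mult_right_mono[OF h3 ed(2)] by simp_all
  moreover have "0 \<le> h ^ 3 * e" "0 \<le> h ^ 3 * d" using h ed by auto
  ultimately have "2 * \<epsilon> + 2 * (h ^ 2 * sqrt B) + \<delta> \<le> 5 * h ^ 3 * (e + d)"
    using main ed unfolding distrib_left by (simp add: algebra_simps)
  then have "dist X W \<le> 5 * h ^ 3 * (e + d)" using dist by linarith
  then show ?thesis using W unfolding cube e_def d_def by blast
qed

lemma nonneg_stiefel_error_bound:
  fixes X :: "real ^ 'r ^ 'n"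
  assumes "CARD('r) \<le> CARD('n)"
  shows "\<exists>W\<in>nonneg_stiefel. dist X W \<le> 5 * real CARD('r) powr (3 / 4)
           * (sqrt (norm (neg_part_matrix X)) + sqrt (norm (transpose X ** X - mat 1)))"
proof (cases "sqrt (norm (neg_part_matrix X)) + sqrt (norm (transpose X ** X - mat 1))
    < 1 / (2 * real CARD('r) powr (1 / 4))")
  case True
  then show ?thesis by (rule exists_nonneg_stiefel_near_small_residual)
next
  case False
  obtain W :: "real ^ 'r ^ 'n" where "W \<in> nonneg_stiefel"
    using nonneg_stiefel_nonempty[OF assms] by blast
  then show ?thesis
    using False by (intro bexI[of _ W] dist_nonneg_stiefel_le_large_residual) auto
qed

section \<open>Entrywise norms and small exponents\<close>

text \<open>
  If the negative part has \<open>\<ell>\<^sub>p\<close>-norm \<open>e \<le> 1\<close>, then \<open>e powr q\<close> dominates \<open>sqrt e\<close>, and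
  the Frobenius bound applies.  If \<open>e > 1\<close>, then \<open>e powr q\<close> may be far below \<open>sqrt e\<close>, but it still
  is at least 1, which is all that the estimate for large residuals asks for.
\<close>
lemma nonneg_stiefel_error_bound_lp:
  fixes X :: "real ^ 'r ^ 'n"
  assumes card: "CARD('r) \<le> CARD('n)" and p: "1 \<le> p" and q: "0 < q" "q \<le> 1 / 2"
  shows "\<exists>W\<in>nonneg_stiefel. dist X W \<le> 5 * real CARD('r) powr (3 / 4)
           * max 1 (real (CARD('n) * CARD('r)) powr ((p - 2) / (4 * p)))
           * (entrywise_lp_norm p (neg_part_matrix X) powr q
              + entrywise_lp_norm p (transpose X ** X - mat 1) powr (1 / 2))"
proof -
  define N where "N = real (CARD('n) * CARD('r))"
  define \<kappa> where "\<kappa> = max 1 (N powr ((p - 2) / (4 * p)))"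
  define C where "C = 5 * real CARD('r) powr (3 / 4)"
  define e where "e = entrywise_lp_norm p (neg_part_matrix X)"
  define d where "d = entrywise_lp_norm p (transpose X ** X - mat 1)"
  have \<kappa>1: "1 \<le> \<kappa>" by (simp add: \<kappa>_def)
  have C0: "0 \<le> C" by (simp add: C_def)
  have ed: "0 \<le> e" "0 \<le> d" by (simp_all add: e_def d_def entrywise_lp_norm_def)
  \<comment> \<open>The exponent is halved because the norms enter the error bound through their square roots.\<close>
  have \<kappa>_sq: "max 1 (N powr ((p - 2) / (2 * p))) = \<kappa>\<^sup>2"
  proof -
    define u where "u = N powr ((p - 2) / (4 * p))"
    have "(p - 2) / (2 * p) = (p - 2) / (4 * p) * 2" using p by (simp add: field_simps)
    then have "N powr ((p - 2) / (2 * p)) = u powr 2" by (simp only: u_def powr_powr)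
    then have "N powr ((p - 2) / (2 * p)) = u ^ 2" by (simp add: u_def)
    moreover have "max 1 (u ^ 2) = (max 1 u) ^ 2"
    proof (cases "1 \<le> u")
      case True
      then show ?thesis by (simp add: max_def)
    next
      case False
      then have "u ^ 2 \<le> 1" by (intro power_le_one) (auto simp: u_def)
      then show ?thesis using False by (simp add: max_def)
    qed
    ultimately show ?thesis by (simp add: \<kappa>_def u_def)
  qed
  have "norm (neg_part_matrix X) \<le> \<kappa>\<^sup>2 * e"
    unfolding \<kappa>_sq[symmetric] e_def by (rule frobenius_le_entrywise_lp_norm) (use p in \<open>auto simp: N_def\<close>)
  then have "sqrt (norm (neg_part_matrix X)) \<le> sqrt (\<kappa>\<^sup>2 * e)" by simp
  then have e_le: "sqrt (norm (neg_part_matrix X)) \<le> \<kappa> * sqrt e"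
    using \<kappa>1 by (simp add: real_sqrt_mult)
  have "norm (transpose X ** X - mat 1) \<le> \<kappa>\<^sup>2 * d"
    unfolding \<kappa>_sq[symmetric] d_def
    by (rule frobenius_le_entrywise_lp_norm) (use p card in \<open>auto simp: N_def simp flip: of_nat_mult\<close>)
  then have "sqrt (norm (transpose X ** X - mat 1)) \<le> sqrt (\<kappa>\<^sup>2 * d)" by simp
  then have d_le: "sqrt (norm (transpose X ** X - mat 1)) \<le> \<kappa> * sqrt d"
    using \<kappa>1 by (simp add: real_sqrt_mult)
  have "\<exists>W\<in>nonneg_stiefel. dist X W \<le> C * (\<kappa> * e powr q + \<kappa> * sqrt d)"
  proof (cases "e \<le> 1")
    case True
    have "sqrt e \<le> e powr q"
      using powr_mono'[OF q(2) ed(1) True] ed by (simp add: powr_half_sqrt)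
    then have "\<kappa> * sqrt e \<le> \<kappa> * e powr q" using \<kappa>1 by (intro mult_left_mono) auto
    then have "C * (sqrt (norm (neg_part_matrix X)) + sqrt (norm (transpose X ** X - mat 1)))
        \<le> C * (\<kappa> * e powr q + \<kappa> * sqrt d)"
      using e_le d_le C0 by (intro mult_left_mono) auto
    then show ?thesis
      using nonneg_stiefel_error_bound[OF card, of X] unfolding C_def[symmetric] by force
  next
    case False
    obtain W :: "real ^ 'r ^ 'n" where W: "W \<in> nonneg_stiefel"
      using nonneg_stiefel_nonempty[OF card] by blast
    have "1 \<le> CARD('r)" by (simp add: Suc_leI)
    then have "1 \<le> real CARD('r) powr (1 / 4)" using powers_of_fourth_root(1)[of "real CARD('r)"] by simp
    then have "1 / (2 * real CARD('r) powr (1 / 4)) \<le> 1" by (simp add: field_simps)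
    then have "1 / (2 * real CARD('r) powr (1 / 4)) \<le> 1 + sqrt (norm (transpose X ** X - mat 1))"
      by (rule order_trans) simp
    then have crude: "dist X W \<le> C * (1 + sqrt (norm (transpose X ** X - mat 1)))"
      unfolding C_def by (intro dist_nonneg_stiefel_le_large_residual W) auto
    have e1: "1 \<le> e powr q" using False q by (intro ge_one_powr_ge_zero) auto
    then have "1 \<le> \<kappa> * e powr q" using mult_mono[OF \<kappa>1 e1] \<kappa>1 by simp
    then have "C * (1 + sqrt (norm (transpose X ** X - mat 1))) \<le> C * (\<kappa> * e powr q + \<kappa> * sqrt d)"
      using d_le C0 by (intro mult_left_mono) auto
    then show ?thesis using crude W by force
  qed
  then show ?thesis
    using ed by (simp add: C_def \<kappa>_def N_def e_def d_def powr_half_sqrt distrib_left mult.assoc)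
qed

theorem theorem10:
  fixes S :: "(real ^ 'r ^ 'n) set"
    and F :: "real ^ 'r ^ 'n \<Rightarrow> real"
    and L p q \<mu> :: real
  assumes "CARD('r) \<le> CARD('n)"
    and "nonneg_stiefel \<subseteq> S"
    and "0 < L"
    and "L-lipschitz_on S F"
    and "1 \<le> p"
    and "0 < q" and "q \<le> 1 / 2"
    and "\<mu> > 5 * L * real CARD('r) powr (3 / 4)
          * max 1 (real (CARD('n) * CARD('r)) powr ((p - 2) / (4 * p)))"
  shows "Argmin F nonneg_stiefel =
    Argmin (\<lambda>X. F X + \<mu> * (entrywise_lp_norm p (neg_part_matrix X) powr q
                 + entrywise_lp_norm p (transpose X ** X - mat 1) powr (1 / 2))) S"
proof (rule Argmin_exact_penalty[OF assms(4) assms(2)])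
  fix X :: "real ^ 'r ^ 'n"
  assume "X \<in> nonneg_stiefel"
  then have "neg_part_matrix X = 0" "transpose X ** X - mat 1 = 0"
    by (auto simp: nonneg_stiefel_def neg_part_matrix_def vec_eq_iff)
  then show "entrywise_lp_norm p (neg_part_matrix X) powr q
      + entrywise_lp_norm p (transpose X ** X - mat 1) powr (1 / 2) = 0"
    by (simp add: entrywise_lp_norm_def)
next
  show "\<exists>W\<in>nonneg_stiefel. dist X W \<le> 5 * real CARD('r) powr (3 / 4)
           * max 1 (real (CARD('n) * CARD('r)) powr ((p - 2) / (4 * p)))
           * (entrywise_lp_norm p (neg_part_matrix X) powr q
              + entrywise_lp_norm p (transpose X ** X - mat 1) powr (1 / 2))"
    for X :: "real ^ 'r ^ 'n"
    by (rule nonneg_stiefel_error_bound_lp[OF assms(1,5-7)])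
qed (use assms(8) in \<open>simp_all add: mult_ac\<close>)

end
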